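(* Let $G$ be a finite group of full exponent, i.e. $G$ contains an element whose order equals the exponent of $G$. Then the order superpower graph $\mathcal{S}(G)$ is minimally edge connected if and only if $G$ is a $p$-group for some prime $p$.
   Context: The order superpower graph $\mathcal{S}(G)$ of a finite group $G$ is the simple undirected graph with vertex set $G$ in which two distinct vertices are adjacent if and only if the order of one of them divides the order of the other. The exponent of $G$ is the least common multiple of the orders of all elements of $G$. A finite group $G$ is a $p$-group if $|G|=p^n$ for some integer $n \ge 0$ (with $p$ prime). The edge connectivity $\kappa'(\Gamma)$ of a graph $\Gamma$ is the minimum size of a set $S$ of edges such that $\Gamma - S$ is disconnected or has only one vertex (so $\kappa'(\Gamma)=0$ if $\Gamma$ is already disconnected or has one vertex). $\Gamma$ is minimally edge connected if $\kappa'(\Gamma-\epsilon)=\kappa'(\Gamma)-1$ for every edge $\epsilon$ of $\Gamma$. *)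

theory Defs
  imports
    "HOL-Algebra.Multiplicative_Group"
    "HOL-Computational_Algebra.Primes"
begin

section \<open>Simple undirected graphs\<close>

record 'a ugraph =
  vertices :: "'a set"
  edges :: "'a set set"

definition finite_simple_graph :: "'a ugraph \<Rightarrow> bool" where
  "finite_simple_graph \<Gamma> \<longleftrightarrow>
     finite (vertices \<Gamma>) \<and> (\<forall>e\<in>edges \<Gamma>. e \<subseteq> vertices \<Gamma> \<and> card e = 2)"

definition adjacency :: "'a ugraph \<Rightarrow> ('a \<times> 'a) set" where
  "adjacency \<Gamma> = {(u, v). {u, v} \<in> edges \<Gamma>}"

definition connected_graph :: "'a ugraph \<Rightarrow> bool" where
  "connected_graph \<Gamma> \<longleftrightarrow>
     (\<forall>u\<in>vertices \<Gamma>. \<forall>v\<in>vertices \<Gamma>. (u, v) \<in> (adjacency \<Gamma>)\<^sup>*)"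

definition delete_edges :: "'a ugraph \<Rightarrow> 'a set set \<Rightarrow> 'a ugraph" where
  "delete_edges \<Gamma> S = \<Gamma>\<lparr>edges := edges \<Gamma> - S\<rparr>"

text \<open>Intended for finite simple graphs with at least one vertex: deleting all edges then
  shows that the minimum ranges over a nonempty set of numbers.\<close>

definition edge_connectivity :: "'a ugraph \<Rightarrow> nat" where
  "edge_connectivity \<Gamma> =
     (LEAST k. \<exists>S\<subseteq>edges \<Gamma>. finite S \<and> card S = k \<and>
        (\<not> connected_graph (delete_edges \<Gamma> S) \<or> card (vertices (delete_edges \<Gamma> S)) = 1))"

text \<open>The subtraction is that of the integers. Truncated subtraction on the natural numbers
  would make every graph of edge connectivity zero minimally edge connected.\<close>

definition minimally_edge_connected :: "'a ugraph \<Rightarrow> bool" where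
  "minimally_edge_connected \<Gamma> \<longleftrightarrow>
     (\<forall>e\<in>edges \<Gamma>.
        int (edge_connectivity (delete_edges \<Gamma> {e})) = int (edge_connectivity \<Gamma>) - 1)"


section \<open>Finite groups and the order superpower graph\<close>

definition group_exponent :: "('a, 'b) monoid_scheme \<Rightarrow> nat" where
  "group_exponent G = Lcm (group.ord G ` carrier G)"

definition full_exponent :: "('a, 'b) monoid_scheme \<Rightarrow> bool" where
  "full_exponent G \<longleftrightarrow> (\<exists>x\<in>carrier G. group.ord G x = group_exponent G)"

definition p_group :: "nat \<Rightarrow> ('a, 'b) monoid_scheme \<Rightarrow> bool" where
  "p_group p G \<longleftrightarrow> prime p \<and> group G \<and> finite (carrier G) \<and> (\<exists>n. order G = p ^ n)"

definition order_superpower_graph :: "('a, 'b) monoid_scheme \<Rightarrow> 'a ugraph" where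
  "order_superpower_graph G =
     \<lparr>vertices = carrier G,
      edges = {{x, y} | x y. x \<in> carrier G \<and> y \<in> carrier G \<and> x \<noteq> y \<and>
                 (group.ord G x dvd group.ord G y \<or> group.ord G y dvd group.ord G x)}\<rparr>"

lemma finite_simple_order_superpower_graph:
  "finite (carrier G) \<Longrightarrow> finite_simple_graph (order_superpower_graph G)"
  by (auto simp: finite_simple_graph_def order_superpower_graph_def)

end

theory Submission
  imports Defs "HOL-Algebra.Sylow"
begin

text \<open>Suppose an edge cut of a graph separates \<open>X\<close> from the other vertices and every vertex of
  \<open>X\<close> has a neighbour outside \<open>X\<close>. Then the cut has at least \<open>deg b\<close> edges for each
  \<open>b \<in> X\<close>: send a neighbour \<open>v\<close> of \<open>b\<close> to the edge \<open>bv\<close> if \<open>v\<close> lies outside \<open>X\<close>, and otherwise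
  to an edge joining \<open>v\<close> to the outside.

  If \<open>G\<close> is a \<open>p\<close>-group, then the graph is complete, and the bound gives edge connectivity
  \<open>n - 1\<close>; deleting an edge lowers a degree to \<open>n - 2\<close>. If \<open>G\<close> is not a \<open>p\<close>-group, then elements
  of distinct prime orders are not adjacent, while the identity and an element whose order is the
  exponent are two vertices adjacent to all others. Deleting the edge between these two keeps
  their degrees at \<open>n - 2\<close>, which is at least the minimum degree, and the bound applies to one side
  of every edge cut that remains. So the edge connectivity does not drop.\<close>

section \<open>Edge cuts and degrees\<close>

definition neighbours :: "'a ugraph \<Rightarrow> 'a \<Rightarrow> 'a set" where
  "neighbours \<Gamma> v = {w. {v, w} \<in> edges \<Gamma>}"

lemma vertices_delete_edges [simp]: "vertices (delete_edges \<Gamma> S) = vertices \<Gamma>"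
  and edges_delete_edges [simp]: "edges (delete_edges \<Gamma> S) = edges \<Gamma> - S"
  by (simp_all add: delete_edges_def)

lemma finite_simple_graph_delete_edges:
  "finite_simple_graph \<Gamma> \<Longrightarrow> finite_simple_graph (delete_edges \<Gamma> S)"
  by (auto simp: finite_simple_graph_def)

lemma finite_edges: "finite_simple_graph \<Gamma> \<Longrightarrow> finite (edges \<Gamma>)"
  by (rule finite_subset[of _ "Pow (vertices \<Gamma>)"]) (auto simp: finite_simple_graph_def)

lemma neighbours_subset:
  assumes "finite_simple_graph \<Gamma>"
  shows "neighbours \<Gamma> v \<subseteq> vertices \<Gamma> - {v}"
  using assms by (fastforce simp: neighbours_def finite_simple_graph_def)

lemma finite_neighbours: "finite_simple_graph \<Gamma> \<Longrightarrow> finite (neighbours \<Gamma> v)"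
  by (rule finite_subset[OF neighbours_subset]) (auto simp: finite_simple_graph_def)

lemma edge_connectivity_le_card:
  assumes "finite_simple_graph \<Gamma>" "S \<subseteq> edges \<Gamma>"
    "\<not> connected_graph (delete_edges \<Gamma> S) \<or> card (vertices \<Gamma>) = 1"
  shows "edge_connectivity \<Gamma> \<le> card S"
  unfolding edge_connectivity_def
  using assms finite_subset[OF assms(2) finite_edges[OF assms(1)]]
  by (intro Least_le) auto

text \<open>The \<open>LEAST\<close> in \<open>edge_connectivity\<close> is attained: once all edges
  are deleted, only equal vertices are joined, so a nonempty graph that stays connected has a single
  vertex.\<close>

lemma obtain_minimum_edge_cut:
  assumes "finite_simple_graph \<Gamma>" "vertices \<Gamma> \<noteq> {}"
  obtains S where "S \<subseteq> edges \<Gamma>" "card S = edge_connectivity \<Gamma>"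
    "\<not> connected_graph (delete_edges \<Gamma> S) \<or> card (vertices \<Gamma>) = 1"
proof -
  let ?D = "delete_edges \<Gamma> (edges \<Gamma>)"
  have "card (vertices \<Gamma>) = 1" if "connected_graph ?D"
  proof -
    have "adjacency ?D = {}"
      by (simp add: adjacency_def)
    then have "\<forall>u\<in>vertices \<Gamma>. \<forall>v\<in>vertices \<Gamma>. u = v"
      using that by (simp add: connected_graph_def)
    then show ?thesis
      using assms(2) by (metis is_singletonI' is_singleton_altdef)
  qed
  then have "\<exists>k. \<exists>S\<subseteq>edges \<Gamma>. finite S \<and> card S = k \<and>
      (\<not> connected_graph (delete_edges \<Gamma> S) \<or> card (vertices (delete_edges \<Gamma> S)) = 1)"
    using finite_edges[OF assms(1)] by auto
  from LeastI_ex[OF this] show thesis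
    using that unfolding edge_connectivity_def[symmetric] by auto
qed

text \<open>Deleting all edges at \<open>v\<close> isolates it, since every walk from
  \<open>v\<close> then stays at \<open>v\<close>; the vertex \<open>w\<close> makes the remaining
  graph disconnected.\<close>

lemma edge_connectivity_le_degree:
  assumes "finite_simple_graph \<Gamma>" "v \<in> vertices \<Gamma>" "w \<in> vertices \<Gamma>" "w \<noteq> v"
  shows "edge_connectivity \<Gamma> \<le> card (neighbours \<Gamma> v)"
proof -
  let ?S = "(\<lambda>w. {v, w}) ` neighbours \<Gamma> v"
  have "(v, x) \<in> (adjacency (delete_edges \<Gamma> ?S))\<^sup>* \<Longrightarrow> x = v" for x
    by (induction rule: rtrancl_induct) (auto simp: adjacency_def neighbours_def)
  then have "\<not> connected_graph (delete_edges \<Gamma> ?S)"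
    using assms by (auto simp: connected_graph_def)
  moreover have "?S \<subseteq> edges \<Gamma>"
    by (auto simp: neighbours_def)
  ultimately have "edge_connectivity \<Gamma> \<le> card ?S"
    using edge_connectivity_le_card[OF assms(1)] by blast
  also have "\<dots> \<le> card (neighbours \<Gamma> v)"
    by (intro card_image_le finite_neighbours assms)
  finally show ?thesis .
qed

text \<open>A minimum cut of the graph without \<open>e\<close>, enlarged by \<open>e\<close>, is a
  cut of \<Gamma>. Hence deleting one edge lowers the edge connectivity by at most one.\<close>

lemma edge_connectivity_le_Suc_delete_edge:
  assumes "finite_simple_graph \<Gamma>" "e \<in> edges \<Gamma>"
  shows "edge_connectivity \<Gamma> \<le> Suc (edge_connectivity (delete_edges \<Gamma> {e}))"
proof -
  have "vertices (delete_edges \<Gamma> {e}) \<noteq> {}"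
    using assms by (fastforce simp: finite_simple_graph_def)
  then obtain S where S: "S \<subseteq> edges (delete_edges \<Gamma> {e})"
    "card S = edge_connectivity (delete_edges \<Gamma> {e})"
    "\<not> connected_graph (delete_edges (delete_edges \<Gamma> {e}) S) \<or>
      card (vertices (delete_edges \<Gamma> {e})) = 1"
    using obtain_minimum_edge_cut finite_simple_graph_delete_edges assms(1) by metis
  have "delete_edges (delete_edges \<Gamma> {e}) S = delete_edges \<Gamma> (insert e S)"
    by (simp add: delete_edges_def Diff_insert2[symmetric])
  then have "edge_connectivity \<Gamma> \<le> card (insert e S)"
    using S assms by (intro edge_connectivity_le_card) auto
  also have "\<dots> \<le> Suc (card S)"
    by (rule card_insert_le_m1) auto
  finally show ?thesis
    using S by simp
qed

lemma disconnecting_set_imp_cut: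
  assumes "\<not> connected_graph (delete_edges \<Gamma> S)"
  obtains T where "T \<subseteq> vertices \<Gamma>" "T \<noteq> {}" "vertices \<Gamma> - T \<noteq> {}"
    "\<forall>a\<in>T. \<forall>b\<in>vertices \<Gamma> - T. {a, b} \<in> edges \<Gamma> \<longrightarrow> {a, b} \<in> S"
proof -
  let ?A = "adjacency (delete_edges \<Gamma> S)"
  obtain u v where uv: "u \<in> vertices \<Gamma>" "v \<in> vertices \<Gamma>" "(u, v) \<notin> ?A\<^sup>*"
    using assms by (auto simp: connected_graph_def)
  \<comment> \<open>The component of \<open>u\<close> after the deletion; an edge leaving it that
    survived would enlarge it.\<close>
  let ?T = "{w \<in> vertices \<Gamma>. (u, w) \<in> ?A\<^sup>*}"
  show thesis
  proof (rule that[of ?T])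
    show "\<forall>a\<in>?T. \<forall>b\<in>vertices \<Gamma> - ?T. {a, b} \<in> edges \<Gamma> \<longrightarrow> {a, b} \<in> S"
    proof (intro ballI impI, rule ccontr)
      fix a b
      assume ab: "a \<in> ?T" "b \<in> vertices \<Gamma> - ?T" "{a, b} \<in> edges \<Gamma>"
      assume "{a, b} \<notin> S"
      then have "(a, b) \<in> ?A"
        using ab by (simp add: adjacency_def)
      then show False
        using ab by (auto intro: rtrancl_into_rtrancl)
    qed
  qed (use uv in auto)
qed

lemma degree_le_card_cut:
  assumes \<Gamma>: "finite_simple_graph \<Gamma>" and "finite S" and "b \<in> X"
    and out: "\<And>v. v \<in> X \<Longrightarrow> \<exists>w\<in>vertices \<Gamma> - X. {v, w} \<in> edges \<Gamma>"
    and cut: "\<And>v w. \<lbrakk>v \<in> X; w \<in> vertices \<Gamma> - X; {v, w} \<in> edges \<Gamma>\<rbrakk> \<Longrightarrow> {v, w} \<in> S"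
  shows "card (neighbours \<Gamma> b) \<le> card S"
proof -
  obtain g where g: "\<And>v. v \<in> X \<Longrightarrow> g v \<in> vertices \<Gamma> - X \<and> {v, g v} \<in> edges \<Gamma>"
    using out by metis
  define f where "f v = (if v \<in> X then {v, g v} else {b, v})" for v
  note sub = neighbours_subset[OF \<Gamma>, of b]
  have "f ` neighbours \<Gamma> b \<subseteq> S"
    using g cut sub \<open>b \<in> X\<close> by (auto simp: f_def neighbours_def)
  \<comment> \<open>An edge \<open>{v, g v}\<close> has \<open>v\<close> as its only end in
    \<open>X\<close>, and \<open>{b, v}\<close> with \<open>v\<close> outside \<open>X\<close> has
    only \<open>b\<close>. So edges of the two kinds could coincide only if \<open>b\<close> were
    its own neighbour.\<close>
  moreover have "inj_on f (neighbours \<Gamma> b)"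
  proof (rule inj_onI)
    fix v w assume "v \<in> neighbours \<Gamma> b" "w \<in> neighbours \<Gamma> b" "f v = f w"
    moreover have "v \<noteq> b" "w \<noteq> b"
      using calculation sub by auto
    ultimately show "v = w"
      using g \<open>b \<in> X\<close> by (auto simp: f_def doubleton_eq_iff split: if_splits)
  qed
  ultimately show ?thesis
    using card_inj_on_le \<open>finite S\<close> by blast
qed

section \<open>Complete graphs and graphs with two dominating vertices\<close>

lemma complete_graph_minimally_edge_connected:
  assumes \<Gamma>: "finite_simple_graph \<Gamma>"
    and complete: "\<And>v w. \<lbrakk>v \<in> vertices \<Gamma>; w \<in> vertices \<Gamma>; v \<noteq> w\<rbrakk> \<Longrightarrow> {v, w} \<in> edges \<Gamma>"
  shows "minimally_edge_connected \<Gamma>"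
  unfolding minimally_edge_connected_def
proof
  fix e assume e: "e \<in> edges \<Gamma>"
  then have "card e = 2" "e \<subseteq> vertices \<Gamma>"
    using \<Gamma> by (auto simp: finite_simple_graph_def)
  then obtain a c where ac: "e = {a, c}" "a \<noteq> c" "a \<in> vertices \<Gamma>" "c \<in> vertices \<Gamma>"
    by (auto simp: card_2_iff)
  let ?n = "card (vertices \<Gamma>)" and ?D = "delete_edges \<Gamma> {e}"
  have fin: "finite (vertices \<Gamma>)"
    using \<Gamma> by (simp add: finite_simple_graph_def)
  have nbs: "neighbours \<Gamma> v = vertices \<Gamma> - {v}" if "v \<in> vertices \<Gamma>" for v
    using complete that neighbours_subset[OF \<Gamma>, of v] by (auto simp: neighbours_def)
  have n: "?n \<ge> 2"
    using card_mono[OF fin, of "{a, c}"] ac by simp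
  have lower: "?n - 1 \<le> edge_connectivity \<Gamma>"
  proof -
    obtain S where S: "S \<subseteq> edges \<Gamma>" "card S = edge_connectivity \<Gamma>"
      "\<not> connected_graph (delete_edges \<Gamma> S) \<or> card (vertices \<Gamma>) = 1"
      using obtain_minimum_edge_cut[OF \<Gamma>] ac by blast
    then have "\<not> connected_graph (delete_edges \<Gamma> S)"
      using n by simp
    then obtain T where T: "T \<subseteq> vertices \<Gamma>" "T \<noteq> {}" "vertices \<Gamma> - T \<noteq> {}"
      "\<forall>a\<in>T. \<forall>b\<in>vertices \<Gamma> - T. {a, b} \<in> edges \<Gamma> \<longrightarrow> {a, b} \<in> S"
      by (rule disconnecting_set_imp_cut)
    then obtain b where b: "b \<in> T"
      by blast
    have "card (neighbours \<Gamma> b) \<le> card S"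
    proof (rule degree_le_card_cut[OF \<Gamma> _ b])
      show "finite S"
        using S finite_edges[OF \<Gamma>] finite_subset by blast
      show "\<exists>w\<in>vertices \<Gamma> - T. {v, w} \<in> edges \<Gamma>" if "v \<in> T" for v
        using T(1,3) complete that by blast
    qed (use T in blast)
    then show ?thesis
      using S b T(1) nbs[of b] fin by (auto simp: card_Diff_singleton)
  qed
  \<comment> \<open>The end \<open>a\<close> of the deleted edge has degree n - 2 in
    \<open>?D\<close>. With the lower bound n - 1 for \<Gamma> and a drop of at most one, this
    forces a drop of exactly one.\<close>
  have "edge_connectivity ?D \<le> card (neighbours ?D a)"
    using ac finite_simple_graph_delete_edges[OF \<Gamma>]
    by (intro edge_connectivity_le_degree[of _ a c]) auto
  also have "neighbours ?D a = vertices \<Gamma> - {a, c}"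
    using nbs[OF ac(3)] ac by (auto simp: neighbours_def doubleton_eq_iff)
  also have "card \<dots> = ?n - 2"
    using ac by (simp add: card_Diff_subset)
  finally show "int (edge_connectivity ?D) = int (edge_connectivity \<Gamma>) - 1"
    using edge_connectivity_le_Suc_delete_edge[OF \<Gamma> e] lower n by linarith
qed

text \<open>The nonadjacent pair serves twice: it gives \<open>u\<close> a degree of at most n - 2,
  and it supplies a vertex \<open>u\<close> besides \<open>a\<close> and \<open>c\<close> that is
  adjacent to both.\<close>

lemma incomplete_not_minimally_edge_connected:
  assumes \<Gamma>: "finite_simple_graph \<Gamma>"
    and ac: "a \<in> vertices \<Gamma>" "c \<in> vertices \<Gamma>" "a \<noteq> c"
    and dom_a: "\<And>v. \<lbrakk>v \<in> vertices \<Gamma>; v \<noteq> a\<rbrakk> \<Longrightarrow> {a, v} \<in> edges \<Gamma>"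
    and dom_c: "\<And>v. \<lbrakk>v \<in> vertices \<Gamma>; v \<noteq> c\<rbrakk> \<Longrightarrow> {c, v} \<in> edges \<Gamma>"
    and uw: "u \<in> vertices \<Gamma>" "w \<in> vertices \<Gamma>" "u \<noteq> w" "{u, w} \<notin> edges \<Gamma>"
  shows "\<not> minimally_edge_connected \<Gamma>"
proof -
  let ?V = "vertices \<Gamma>" and ?D = "delete_edges \<Gamma> {{a, c}}"
  have D: "finite_simple_graph ?D"
    by (rule finite_simple_graph_delete_edges[OF \<Gamma>])
  have fin: "finite ?V"
    using \<Gamma> by (simp add: finite_simple_graph_def)
  have u: "u \<noteq> a" "u \<noteq> c"
    using dom_a dom_c uw by auto
  have adj: "{v, a} \<in> edges ?D" "{v, c} \<in> edges ?D" "{a, v} \<in> edges ?D" "{c, v} \<in> edges ?D"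
    if "v \<in> ?V" "v \<noteq> a" "v \<noteq> c" for v
    using that dom_a[of v] dom_c[of v] by (auto simp: doubleton_eq_iff insert_commute)
  obtain S where S: "S \<subseteq> edges ?D" "card S = edge_connectivity ?D"
    "\<not> connected_graph (delete_edges ?D S) \<or> card ?V = 1"
    using obtain_minimum_edge_cut[OF D] ac by auto
  have "card ?V \<noteq> 1"
    using ac by (auto simp: card_1_singleton_iff)
  then have "\<not> connected_graph (delete_edges ?D S)"
    using S by simp
  then obtain T where T: "T \<subseteq> ?V" "T \<noteq> {}" "?V - T \<noteq> {}"
    "\<forall>a\<in>T. \<forall>b\<in>?V - T. {a, b} \<in> edges ?D \<longrightarrow> {a, b} \<in> S"
    by (rule disconnecting_set_imp_cut) simp
  \<comment> \<open>The cut condition read from the other side, so that either side can serve as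
    \<open>X\<close> in \<open>degree_le_card_cut\<close>.\<close>
  have T': "\<forall>b\<in>?V - T. \<forall>a\<in>T. {b, a} \<in> edges ?D \<longrightarrow> {b, a} \<in> S"
  proof (intro ballI impI)
    fix x y assume "x \<in> ?V - T" "y \<in> T" "{x, y} \<in> edges ?D"
    moreover have "{x, y} = {y, x}"
      by blast
    ultimately show "{x, y} \<in> S"
      using T(4) by metis
  qed
  have compl: "?V - (?V - T) = T"
    using T(1) by blast
  \<comment> \<open>Every vertex of \<open>X\<close> has a neighbour across the cut, as
    \<open>degree_le_card_cut\<close> demands.\<close>
  define good where "good X \<longleftrightarrow> (\<forall>v\<in>X. \<exists>w\<in>?V - X. {v, w} \<in> edges ?D)" for X
  \<comment> \<open>The cut separates \<open>a\<close> from \<open>c\<close>, with \<open>x\<close>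
    in \<open>T\<close>. If \<open>T\<close> is just \<open>{x}\<close>, then \<open>u\<close> is a
    neighbour of \<open>x\<close> across the cut. Otherwise another \<open>t\<close> in
    \<open>T\<close> is a neighbour of \<open>y\<close>, and every further vertex outside
    \<open>T\<close> is adjacent to \<open>x\<close>.\<close>
  have good_sep: "good (?V - T) \<or> good T"
    if xy: "{x, y} = {a, c}" "x \<in> T" "y \<notin> T" for x y
  proof (cases "T = {x}")
    case True
    have "{x, u} \<in> edges ?D" "u \<in> ?V - T"
      using adj[OF uw(1) u] uw(1) u xy True by (auto simp: doubleton_eq_iff)
    then show ?thesis
      using True by (auto simp: good_def)
  next
    case False
    then obtain t where t: "t \<in> T" "t \<noteq> x"
      using xy by blast
    then have yt: "{y, t} \<in> edges ?D"
      using adj[of t] T(1) xy by (auto simp: doubleton_eq_iff)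
    have "\<exists>w\<in>T. {v, w} \<in> edges ?D" if "v \<in> ?V" "v \<notin> T" for v
      using yt t adj[of v] that xy by (cases "v = y") (auto simp: doubleton_eq_iff)
    then show ?thesis
      by (simp add: good_def compl)
  qed
  \<comment> \<open>If \<open>a\<close> and \<open>c\<close> lie on the same side, every vertex of
    the opposite side is adjacent to \<open>a\<close>.\<close>
  have "good (?V - T) \<or> good T"
  proof (cases "a \<in> T"; cases "c \<in> T")
    assume "a \<in> T" "c \<in> T"
    then have "\<exists>w\<in>T. {v, w} \<in> edges ?D" if "v \<in> ?V - T" for v
      using adj(1)[of v] that by blast
    then have "good (?V - T)"
      unfolding good_def compl by blast
    then show ?thesis ..
  next
    assume "a \<notin> T" "c \<notin> T"
    then have "\<exists>w\<in>?V - T. {v, w} \<in> edges ?D" if "v \<in> T" for v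
      using adj(1)[of v] that ac(1) T(1) by blast
    then have "good T"
      unfolding good_def by blast
    then show ?thesis ..
  qed (use good_sep[of a c] good_sep[of c a] in auto)
  then obtain X where X: "X \<subseteq> ?V" "X \<noteq> {}" "good X"
    "\<forall>v\<in>X. \<forall>w\<in>?V - X. {v, w} \<in> edges ?D \<longrightarrow> {v, w} \<in> S"
  proof
    assume "good (?V - T)"
    with T(3) T' show ?thesis
      using that[of "?V - T"] unfolding compl by blast
  next
    assume "good T"
    with T show ?thesis
      using that[of T] by blast
  qed
  then obtain b where b: "b \<in> X"
    by blast
  have "finite S"
    using S finite_edges[OF D] finite_subset by blast
  then have deg: "card (neighbours ?D b) \<le> edge_connectivity ?D"
    using degree_le_card_cut[OF D _ b, of S] X S by (simp add: good_def)
  have "edge_connectivity \<Gamma> \<le> card (neighbours ?D b)"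
  proof (cases "b = a \<or> b = c")
    case True
    \<comment> \<open>Here \<open>b\<close> has lost an edge, so its own degree in \<Gamma> is no
      help; the degree of \<open>u\<close> is compared instead, as \<open>u\<close> misses both
      itself and \<open>w\<close>.\<close>
    have "edge_connectivity \<Gamma> \<le> card (neighbours \<Gamma> u)"
      using edge_connectivity_le_degree[OF \<Gamma>] uw by metis
    also have "\<dots> \<le> card (?V - {u, w})"
      using neighbours_subset[OF \<Gamma>, of u] uw fin
      by (intro card_mono) (auto simp: neighbours_def)
    also have "\<dots> = card (?V - {a, c})"
      using ac uw by (simp add: card_Diff_subset)
    also have "\<dots> \<le> card (neighbours ?D b)"
      using adj True by (intro card_mono finite_neighbours[OF D]) (auto simp: neighbours_def)
    finally show ?thesis .
  next
    case False
    then have "neighbours ?D b = neighbours \<Gamma> b"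
      by (auto simp: neighbours_def doubleton_eq_iff)
    then show ?thesis
      using edge_connectivity_le_degree[OF \<Gamma>, of b a] False X(1) b ac by auto
  qed
  then have "edge_connectivity \<Gamma> \<le> edge_connectivity ?D"
    using deg by simp
  moreover have "{a, c} \<in> edges \<Gamma>"
    using dom_a ac by auto
  ultimately show ?thesis
    unfolding minimally_edge_connected_def by force
qed

section \<open>Order superpower graphs\<close>

lemma (in group) cauchy:
  assumes "finite (carrier G)" "prime p" "p dvd order G"
  obtains x where "x \<in> carrier G" "ord x = p"
proof -
  \<comment> \<open>Sylow's theorem is applied with exponent 1, where \<open>m\<close> may still be
    divisible by \<open>p\<close>; it yields a subgroup of order \<open>p\<close>, in which any
    nonidentity element will do.\<close>
  obtain m where "order G = p ^ 1 * m"
    using assms by auto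
  then obtain H where H: "subgroup H G" "card H = p"
    using sylow_thm[OF assms(2) is_group _ assms(1), of 1 m] power_one_right[of p] by metis
  interpret H: subgroup H G
    by fact
  have "\<not> H \<subseteq> {\<one>}"
  proof
    assume "H \<subseteq> {\<one>}"
    then have "p \<le> 1"
      using card_mono[of "{\<one>}" H] H by simp
    then show False
      using prime_gt_1_nat[OF assms(2)] by simp
  qed
  then obtain x where x: "x \<in> H" "x \<noteq> \<one>"
    by blast
  interpret HG: group "G\<lparr>carrier := H\<rparr>"
    by (rule H.subgroup_is_group[OF is_group])
  have "x [^]\<^bsub>G\<lparr>carrier := H\<rparr>\<^esub> order (G\<lparr>carrier := H\<rparr>) = \<one>\<^bsub>G\<lparr>carrier := H\<rparr>\<^esub>"
    using x by (intro HG.pow_order_eq_1) auto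
  then have "x [^] p = \<one>"
    using H by (simp add: nat_pow_def order_def)
  then have "ord x dvd p"
    using x by (simp add: pow_eq_id)
  moreover have "ord x \<noteq> 1"
    using ord_eq_1[OF H.mem_carrier] x by auto
  ultimately show thesis
    using that[of x] x assms(2) by (auto simp: prime_nat_iff)
qed

text \<open>Split off the full power of one prime divisor \<open>p\<close>. The cofactor is not 1,
  and its prime divisors differ from \<open>p\<close>.\<close>

lemma not_prime_power_two_primes:
  fixes n :: nat
  assumes "n \<noteq> 0" "\<nexists>p k. prime p \<and> n = p ^ k"
  obtains p q where "prime p" "prime q" "p \<noteq> q" "p dvd n" "q dvd n"
proof -
  \<comment> \<open>The number 1 is the prime power 2^0, so it is excluded by assumption.\<close>
  have "n \<noteq> 1"
    using assms(2) two_is_prime_nat power_0 by metis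
  then obtain p where p: "prime p" "p dvd n"
    using prime_factor_nat by blast
  then obtain m where m: "n = p ^ multiplicity p n * m" "\<not> p dvd m"
    using multiplicity_decompose'[of n p] assms(1) not_prime_unit by metis
  then have "m \<noteq> 1"
    using assms(2) p by (metis mult.right_neutral)
  then obtain q where "prime q" "q dvd m"
    using prime_factor_nat by blast
  then show thesis
    using that[of p q] p m by (metis dvd_mult)
qed

theorem corollary2p7:
  fixes G :: "('a, 'b) monoid_scheme"
  assumes "group G" and "finite (carrier G)"
    and "full_exponent G"
  shows "minimally_edge_connected (order_superpower_graph G) \<longleftrightarrow> (\<exists>p. p_group p G)"
proof
  let ?\<Gamma> = "order_superpower_graph G"
  interpret group G
    by fact
  have \<Gamma>: "finite_simple_graph ?\<Gamma>"
    by (rule finite_simple_order_superpower_graph[OF assms(2)])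
  have V: "vertices ?\<Gamma> = carrier G"
    by (simp add: order_superpower_graph_def)
  have E: "{x, y} \<in> edges ?\<Gamma> \<longleftrightarrow>
      x \<in> carrier G \<and> y \<in> carrier G \<and> x \<noteq> y \<and> (ord x dvd ord y \<or> ord y dvd ord x)" for x y
    by (auto simp: order_superpower_graph_def doubleton_eq_iff)
  show "minimally_edge_connected ?\<Gamma>" if pg: "\<exists>p. p_group p G"
  proof -
    obtain p n where p: "prime p" "order G = p ^ n"
      using pg by (auto simp: p_group_def)
    \<comment> \<open>Powers of one prime form a chain under divisibility, so the graph is
      complete.\<close>
    have "\<exists>k. ord x = p ^ k" if "x \<in> carrier G" for x
      using ord_dvd_group_order[OF that] p by (auto simp: divides_primepow_nat)
    then have "ord x dvd ord y \<or> ord y dvd ord x" if "x \<in> carrier G" "y \<in> carrier G" for x y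
      using that by (metis le_imp_power_dvd linorder_linear)
    then show ?thesis
      by (intro complete_graph_minimally_edge_connected[OF \<Gamma>]) (auto simp: V E)
  qed
  show "\<exists>p. p_group p G" if "minimally_edge_connected ?\<Gamma>"
  proof (rule ccontr)
    assume "\<nexists>p. p_group p G"
    then have "\<nexists>p k. prime p \<and> order G = p ^ k"
      using assms by (auto simp: p_group_def)
    moreover have "order G \<noteq> 0"
      using assms(2) order_gt_0_iff_finite by simp
    ultimately obtain p q where pq: "prime p" "prime q" "p \<noteq> q" "p dvd order G" "q dvd order G"
      using not_prime_power_two_primes by metis
    obtain y where y: "y \<in> carrier G" "ord y = p"
      using cauchy[OF assms(2) pq(1,4)] .
    obtain z where z: "z \<in> carrier G" "ord z = q"
      using cauchy[OF assms(2) pq(2,5)] .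
    obtain x where x: "x \<in> carrier G" "ord x = group_exponent G"
      using assms(3) by (auto simp: full_exponent_def)
    \<comment> \<open>Thus \<open>x\<close> is adjacent to all other vertices, as is the identity,
      whose order is 1. They differ because the prime \<open>p\<close> divides
      \<open>ord x\<close>.\<close>
    then have dvd_x: "ord v dvd ord x" if "v \<in> carrier G" for v
      using that by (auto simp: group_exponent_def)
    have "ord x \<noteq> 1"
      using dvd_x[OF y(1)] y(2) pq(1) by auto
    then have "\<one>\<^bsub>G\<^esub> \<noteq> x"
      by auto
    moreover have "{y, z} \<notin> edges ?\<Gamma>"
      using y z pq primes_dvd_imp_eq[of p q] primes_dvd_imp_eq[of q p] by (auto simp: E)
    moreover have "y \<noteq> z"
      using y z pq by auto
    ultimately have "\<not> minimally_edge_connected ?\<Gamma>"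
      using x y z dvd_x
      by (intro incomplete_not_minimally_edge_connected[OF \<Gamma>, of "\<one>\<^bsub>G\<^esub>" x y z]) (auto simp: V E)
    then show False
      using that by contradiction
  qed
qed

end
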